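(* Consider a new seller in the E-commerce reputation model described in the context, who advertises honestly. Let $T_r = d\cdot\min\{\tau\in\{0,1,2,\ldots\} : r(\tau)\ge r_h\}$ be the ramp up time. Then $$E[T_r] = d \sum_{\tau=1}^\infty \left(1 - \sum_{k=r_h}^{\infty} e^{-\lambda_1 P_{ba}(\tau-1)d}\,\frac{(\lambda_1 P_{ba}(\tau-1)d)^k}{k!}\right).$$ Moreover, $E[T_r]$ increases in the reputation threshold $r_h$ (with $\lambda_1P_{ba}$ and $d$ fixed), and decreases in the transaction arrival rate $\lambda_1 P_{ba}$ (with $r_h$ and $d$ fixed).
   Context: Time is divided into slots; slot $\tau\in\{0,1,2,\ldots\}$ is the interval $[\tau d,(\tau+1)d)$, where $d>0$ is the shipment delay. A seller has an integer reputation score $r(\tau)$ in slot $\tau$, with $r(0)=0$. Let $N(\tau)$ be the number of products sold (transactions) in slot $\tau$. The seller is honest (advertised quality equals intrinsic quality $Q_i$), so every transaction yields a positive feedback $+1$, and $r(\tau+1)=r(\tau)+N(\tau)$. The reputation threshold $r_h\ge 1$ is an integer. A seller is labeled reputable if $r\ge r_h$ and the fraction of positive feedbacks is at least a given $\theta\in(0,1]$ (this second condition is automatic for an honest seller), and is labeled average otherwise. Buyers arrive at the seller's store according to a Poisson process with rate $\lambda_1>0$ during slots $\tau$ with $r(\tau)<r_h$ and with rate $\lambda_2>\lambda_1$ during slots $\tau$ with $r(\tau)\ge r_h$. Each arriving buyer independently buys one product, with probability $P_{ba}=\mathcal{P}(\beta Q_i,p)$ if the seller is labeled average and $P_{br}=\mathcal{P}(Q_i,p)$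 if the seller is labeled reputable. Here $\mathcal{P}(Q,p)\in[0,1]$ is increasing in the quality $Q$ and decreasing in the price $p$, $\beta\in[0,1]$ is a discounting factor, and $P_{ba}>0$. Hence, given the history up to time $\tau d$, $N(\tau)$ is Poisson distributed with parameter $\lambda_1P_{ba}d$ if $r(\tau)<r_h$ and $\lambda_2P_{br}d$ if $r(\tau)\ge r_h$. *)

theory Defs
  imports "HOL-Probability.Probability"
begin

record market =
  slot_len :: real                      (* d *)
  arrival_avg :: real                   (* lambda_1 *)
  arrival_rep :: real                   (* lambda_2 *)
  buy_prob :: "real \<Rightarrow> real \<Rightarrow> real"     (* P(Q, p): perceived quality, price *)
  quality :: real                       (* Q_i; the advertised quality of an honest seller *)
  price :: real
  discount :: real                      (* beta *)
  rep_threshold :: nat                  (* r_h *)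
  pos_threshold :: real                 (* theta *)

definition P_ba :: "market \<Rightarrow> real" where
  "P_ba E = buy_prob E (discount E * quality E) (price E)"

definition P_br :: "market \<Rightarrow> real" where
  "P_br E = buy_prob E (quality E) (price E)"

definition transaction_rate :: "market \<Rightarrow> real" where
  "transaction_rate E = arrival_avg E * P_ba E"

definition valid_market :: "market \<Rightarrow> bool" where
  "valid_market E \<longleftrightarrow>
     0 < slot_len E \<and>
     0 < arrival_avg E \<and> arrival_avg E < arrival_rep E \<and>
     (\<forall>Q p. 0 \<le> buy_prob E Q p \<and> buy_prob E Q p \<le> 1) \<and>
     (\<forall>p. mono (\<lambda>Q. buy_prob E Q p)) \<and> (\<forall>Q. antimono (\<lambda>p. buy_prob E Q p)) \<and>
     0 \<le> discount E \<and> discount E \<le> 1 \<and>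
     1 \<le> rep_threshold E \<and>
     0 < pos_threshold E \<and> pos_threshold E \<le> 1 \<and>
     0 < P_ba E"

text \<open>
  Buyers are numbered 0, 1, 2, ... in order of arrival.  \<^term>\<open>C t \<omega>\<close> is the number of buyers
  arriving in the time interval \<open>[0, t)\<close>, so that the buyers \<open>j\<close> with
  \<open>C s \<omega> \<le> j < C t \<omega>\<close> are those arriving in \<open>[s, t)\<close>; \<^term>\<open>B j \<omega>\<close> says that buyer \<open>j\<close> buys.
\<close>

definition slot_start :: "market \<Rightarrow> nat \<Rightarrow> real" where
  "slot_start E \<tau> = real \<tau> * slot_len E"

definition sales ::
  "market \<Rightarrow> (real \<Rightarrow> 'a \<Rightarrow> nat) \<Rightarrow> (nat \<Rightarrow> 'a \<Rightarrow> bool) \<Rightarrow> nat \<Rightarrow> 'a \<Rightarrow> nat" where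
  "sales E C B \<tau> \<omega> =
     card {j. C (slot_start E \<tau>) \<omega> \<le> j \<and> j < C (slot_start E (Suc \<tau>)) \<omega> \<and> B j \<omega>}"

text \<open>
  The seller is honest: every transaction yields a feedback \<open>+1\<close>.  Hence the score is increased
  by the number of sales, stays a natural number, and all feedbacks are positive.
\<close>

primrec reputation ::
  "market \<Rightarrow> (real \<Rightarrow> 'a \<Rightarrow> nat) \<Rightarrow> (nat \<Rightarrow> 'a \<Rightarrow> bool) \<Rightarrow> nat \<Rightarrow> 'a \<Rightarrow> nat" where
  "reputation E C B 0 \<omega> = 0"
| "reputation E C B (Suc \<tau>) \<omega> = reputation E C B \<tau> \<omega> + sales E C B \<tau> \<omega>"

definition feedbacks ::
  "market \<Rightarrow> (real \<Rightarrow> 'a \<Rightarrow> nat) \<Rightarrow> (nat \<Rightarrow> 'a \<Rightarrow> bool) \<Rightarrow> nat \<Rightarrow> 'a \<Rightarrow> nat" where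
  "feedbacks E C B \<tau> \<omega> = (\<Sum>i<\<tau>. sales E C B i \<omega>)"

definition positive_feedbacks ::
  "market \<Rightarrow> (real \<Rightarrow> 'a \<Rightarrow> nat) \<Rightarrow> (nat \<Rightarrow> 'a \<Rightarrow> bool) \<Rightarrow> nat \<Rightarrow> 'a \<Rightarrow> nat" where
  "positive_feedbacks E C B \<tau> \<omega> = (\<Sum>i<\<tau>. sales E C B i \<omega>)"

definition labeled_reputable ::
  "market \<Rightarrow> (real \<Rightarrow> 'a \<Rightarrow> nat) \<Rightarrow> (nat \<Rightarrow> 'a \<Rightarrow> bool) \<Rightarrow> nat \<Rightarrow> 'a \<Rightarrow> bool" where
  "labeled_reputable E C B \<tau> \<omega> \<longleftrightarrow>
     rep_threshold E \<le> reputation E C B \<tau> \<omega> \<and>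
     pos_threshold E \<le> real (positive_feedbacks E C B \<tau> \<omega>) / real (feedbacks E C B \<tau> \<omega>)"

definition arrival_rate ::
  "market \<Rightarrow> (real \<Rightarrow> 'a \<Rightarrow> nat) \<Rightarrow> (nat \<Rightarrow> 'a \<Rightarrow> bool) \<Rightarrow> nat \<Rightarrow> 'a \<Rightarrow> real" where
  "arrival_rate E C B \<tau> \<omega> =
     (if reputation E C B \<tau> \<omega> < rep_threshold E then arrival_avg E else arrival_rep E)"

definition purchase_prob ::
  "market \<Rightarrow> (real \<Rightarrow> 'a \<Rightarrow> nat) \<Rightarrow> (nat \<Rightarrow> 'a \<Rightarrow> bool) \<Rightarrow> nat \<Rightarrow> 'a \<Rightarrow> real" where
  "purchase_prob E C B \<tau> \<omega> = (if labeled_reputable E C B \<tau> \<omega> then P_br E else P_ba E)"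

text \<open>
  \<^term>\<open>F t\<close> is the history up to time \<open>t\<close>; it contains at least the arrivals before \<open>t\<close> and the
  decisions of the buyers who arrived before \<open>t\<close>.  The assumption \<open>marked_Poisson\<close> says that,
  conditionally on \<open>F s\<close> and as long as one stays within slot \<open>\<tau>\<close>, arrivals form a Poisson process
  of rate \<^term>\<open>arrival_rate E C B \<tau> \<omega>\<close> and, independently of it and of each other, the arriving
  buyers buy with probability \<^term>\<open>purchase_prob E C B \<tau> \<omega>\<close>: it gives the joint conditional
  law of the number \<open>n\<close> of arrivals in \<open>[s, t)\<close> and of the decisions \<open>b 0, ..., b (n - 1)\<close> of
  these buyers.
\<close>

locale honest_seller = prob_space M + filtration "space M" F
  for M :: "'a measure" and F :: "real \<Rightarrow> 'a measure" +
  fixes E :: market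
    and C :: "real \<Rightarrow> 'a \<Rightarrow> nat"
    and B :: "nat \<Rightarrow> 'a \<Rightarrow> bool"
  assumes valid: "valid_market E"
    and history: "\<And>t. subalgebra M (F t)"
    and no_arrivals: "\<And>\<omega>. \<omega> \<in> space M \<Longrightarrow> C 0 \<omega> = 0"
    and counting: "\<And>s t \<omega>. \<omega> \<in> space M \<Longrightarrow> 0 \<le> s \<Longrightarrow> s \<le> t \<Longrightarrow> C s \<omega> \<le> C t \<omega>"
    and arrivals_adapted: "\<And>t. 0 \<le> t \<Longrightarrow> C t \<in> measurable (F t) (count_space UNIV)"
    and decisions_measurable: "\<And>j. {\<omega> \<in> space M. B j \<omega>} \<in> sets M"
    and decisions_adapted: "\<And>t j. 0 \<le> t \<Longrightarrow> {\<omega> \<in> space M. j < C t \<omega> \<and> B j \<omega>} \<in> sets (F t)"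
    and marked_Poisson:
      "\<And>\<tau> s t n b. slot_start E \<tau> \<le> s \<Longrightarrow> s < t \<Longrightarrow> t \<le> slot_start E (Suc \<tau>) \<Longrightarrow>
         AE \<omega> in M.
           real_cond_exp M (F s)
             (indicator {\<omega>' \<in> space M. C t \<omega>' - C s \<omega>' = n \<and> (\<forall>j<n. B (C s \<omega>' + j) \<omega>' = b j)}) \<omega>
           = pmf (poisson_pmf (arrival_rate E C B \<tau> \<omega> * (t - s))) n *
             (\<Prod>j<n. pmf (bernoulli_pmf (purchase_prob E C B \<tau> \<omega>)) (b j))"

text \<open>The ramp up time is infinite on the outcomes where the threshold is never reached.\<close>

definition ramp_up_time ::
  "market \<Rightarrow> (real \<Rightarrow> 'a \<Rightarrow> nat) \<Rightarrow> (nat \<Rightarrow> 'a \<Rightarrow> bool) \<Rightarrow> 'a \<Rightarrow> ennreal" where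
  "ramp_up_time E C B \<omega> =
     (if \<exists>\<tau>. rep_threshold E \<le> reputation E C B \<tau> \<omega>
      then ennreal (slot_len E * real (LEAST \<tau>. rep_threshold E \<le> reputation E C B \<tau> \<omega>))
      else \<infinity>)"

definition expected_ramp_up_time ::
  "'a measure \<Rightarrow> market \<Rightarrow> (real \<Rightarrow> 'a \<Rightarrow> nat) \<Rightarrow> (nat \<Rightarrow> 'a \<Rightarrow> bool) \<Rightarrow> ennreal" where
  "expected_ramp_up_time M E C B = (\<integral>\<^sup>+ \<omega>. ramp_up_time E C B \<omega> \<partial>M)"

end

theory Submission
  imports Defs
begin

text \<open>
  While the reputation is below the threshold, a seller's sales per slot are conditionally Poisson
  with parameter \<open>x = \<lambda>\<^sub>1 P\<^sub>b\<^sub>a d\<close>.  A score \<open>m < r\<^sub>h\<close> can only be reached through scores at most \<open>m\<close>,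
  so the law of \<open>r(\<tau>)\<close> agrees below \<open>r\<^sub>h\<close> with the Poisson law of parameter \<open>x \<tau>\<close>, whatever happens
  after the threshold.  Summing \<open>P(T\<^sub>r > \<tau> d) = P(r(\<tau>) < r\<^sub>h)\<close> over \<open>\<tau>\<close> gives the expectation, and
  the monotonicity claims hold term by term for the Poisson distribution function, strictly
  for \<open>\<tau> = 1\<close>.
\<close>

section \<open>Poisson weights: total mass, convolution and thinning\<close>

text \<open>The Poisson mass function as a plain function of \<open>x\<close>, meaningful also at
  \<open>x = 0\<close>, the parameter of the score in slot 0, where it is the point mass at
  0.\<close>

definition poisson_weight :: "real \<Rightarrow> nat \<Rightarrow> real" where
  "poisson_weight x k = exp (- x) * (x ^ k / fact k)"

text \<open>The probability that a Poisson variable with parameter \<open>x\<close> is strictly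
  below \<open>r\<close>, so the index is shifted by one against the usual distribution
  function.\<close>

definition poisson_cdf :: "nat \<Rightarrow> real \<Rightarrow> real" where
  "poisson_cdf r x = (\<Sum>k<r. poisson_weight x k)"

lemma poisson_weight_nonneg: "0 \<le> x \<Longrightarrow> 0 \<le> poisson_weight x k"
  by (simp add: poisson_weight_def)

lemma poisson_weight_pos: "0 < x \<Longrightarrow> 0 < poisson_weight x k"
  by (simp add: poisson_weight_def)

lemma pmf_poisson_eq_weight: "0 < x \<Longrightarrow> pmf (poisson_pmf x) k = poisson_weight x k"
  by (simp add: poisson_weight_def mult.commute)

lemma poisson_weight_zero: "poisson_weight 0 k = (if k = 0 then 1 else 0)"
  by (simp add: poisson_weight_def power_0_left)

lemma exp_sums_divide: "(\<lambda>k. x ^ k / fact k) sums exp (x :: real)"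
  using exp_converges[of x] by (simp add: scaleR_conv_of_real field_simps)

lemma poisson_weight_sums: "poisson_weight x sums 1"
  unfolding poisson_weight_def
  using sums_mult[OF exp_sums_divide[of x], of "exp (- x)"] by (simp add: exp_minus)

text \<open>Removes the first \<open>r\<close> weights from the total mass 1. This evaluates the
  inner series of the theorem.\<close>

lemma poisson_weight_has_sum_atLeast:
  assumes "0 \<le> x"
  shows "(poisson_weight x has_sum (1 - poisson_cdf r x)) {r..}"
proof -
  have "(poisson_weight x has_sum 1) UNIV"
    using poisson_weight_sums[of x] poisson_weight_nonneg[OF assms]
    by (intro norm_summable_imp_has_sum) (auto simp: sums_iff)
  moreover have "(poisson_weight x has_sum poisson_cdf r x) {..<r}"
    by (simp add: poisson_cdf_def)
  ultimately have "(poisson_weight x has_sum (1 - poisson_cdf r x)) (UNIV - {..<r})"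
    by (intro has_sum_Diff) auto
  also have "UNIV - {..<r} = {r..}"
    by auto
  finally show ?thesis .
qed

text \<open>The binomial theorem divided by \<open>fact m\<close>, with the exponential factors
  multiplied in: independent Poisson variables add up to a Poisson variable.\<close>

lemma poisson_weight_convolution:
  "poisson_weight (x + y) m = (\<Sum>k\<le>m. poisson_weight x k * poisson_weight y (m - k))"
proof -
  have "(x + y) ^ m / fact m = (\<Sum>k\<le>m. (x ^ k / fact k) * (y ^ (m - k) / fact (m - k)))"
    using exp_series_add_commuting[OF mult.commute[of x y], of m]
    by (simp add: divide_inverse mult.commute scaleR_conv_of_real)
  then have "poisson_weight (x + y) m =
      (exp (- x) * exp (- y)) * (\<Sum>k\<le>m. (x ^ k / fact k) * (y ^ (m - k) / fact (m - k)))"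
    by (simp add: poisson_weight_def flip: exp_add)
  then show ?thesis
    by (simp add: poisson_weight_def sum_distrib_left mult_ac)
qed

text \<open>Keeping each of a Poisson number of points with probability \<open>p\<close> leaves a
  Poisson number. Terms with \<open>n < l\<close> vanish with the binomial coefficient; after a
  shift by \<open>l\<close> the factorials cancel and an exponential series in
  \<open>x * (1 - p)\<close> remains.\<close>

lemma poisson_weight_thinning:
  "(\<lambda>n. poisson_weight x n * (real (n choose l) * (p ^ l * (1 - p) ^ (n - l))))
     sums poisson_weight (x * p) l"
    (is "?f sums _")
proof -
  have shift: "?f (n + l) = exp (- x) * ((x * p) ^ l / fact l) * ((x * (1 - p)) ^ n / fact n)" for n
    by (simp add: poisson_weight_def binomial_fact power_add power_mult_distrib)
  have "exp (- x) * exp (x * (1 - p)) = exp (- (x * p))"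
    by (simp flip: exp_add add: algebra_simps)
  then have "exp (- x) * ((x * p) ^ l / fact l) * exp (x * (1 - p)) = poisson_weight (x * p) l"
    by (simp add: poisson_weight_def mult_ac)
  then have "(\<lambda>n. ?f (n + l)) sums poisson_weight (x * p) l"
    unfolding shift by (metis sums_mult exp_sums_divide)
  then have "?f sums (poisson_weight (x * p) l + (\<Sum>i<l. ?f i))"
    by (rule sums_iff_shift[THEN iffD1])
  moreover have "(\<Sum>i<l. ?f i) = 0"
    by (intro sum.neutral) auto
  ultimately show ?thesis
    by simp
qed

section \<open>Monotonicity of the Poisson distribution function and of its sum over slots\<close>

lemma poisson_cdf_nonneg: "0 \<le> x \<Longrightarrow> 0 \<le> poisson_cdf r x"
  by (auto simp: poisson_cdf_def poisson_weight_nonneg intro!: sum_nonneg)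

lemma poisson_cdf_mono: "0 \<le> x \<Longrightarrow> r \<le> r' \<Longrightarrow> poisson_cdf r x \<le> poisson_cdf r' x"
  by (auto simp: poisson_cdf_def poisson_weight_nonneg intro!: sum_mono2)

lemma poisson_cdf_strict_mono:
  assumes "0 < x" "r < r'"
  shows "poisson_cdf r x < poisson_cdf r' x"
  unfolding poisson_cdf_def
  using assms poisson_weight_pos[OF assms(1)] poisson_weight_nonneg[of x]
  by (intro sum_strict_mono2[where b = r]) auto

text \<open>For positive \<open>k\<close>, the weight at \<open>k\<close> has as derivative the
  weight at \<open>k - 1\<close> minus the weight at \<open>k\<close>, so the sum telescopes to its
  last term.\<close>

lemma poisson_cdf_has_real_derivative:
  "(poisson_cdf (Suc r) has_real_derivative - poisson_weight x r) (at x)"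
proof (induction r)
  case 0
  show ?case
    unfolding poisson_cdf_def poisson_weight_def by (auto intro!: derivative_eq_intros)
next
  case (Suc r)
  have eq: "poisson_cdf (Suc (Suc r)) = (\<lambda>x. poisson_cdf (Suc r) x + poisson_weight x (Suc r))"
    by (simp add: poisson_cdf_def fun_eq_iff)
  have "((\<lambda>x. poisson_weight x (Suc r)) has_real_derivative
          poisson_weight x r - poisson_weight x (Suc r)) (at x)"
  proof -
    have "((\<lambda>x. exp (- x) * x ^ Suc r / fact (Suc r)) has_real_derivative
        (exp (- x) * (real (Suc r) * x ^ r) - exp (- x) * x ^ Suc r) / fact (Suc r)) (at x)"
      by (rule derivative_eq_intros refl | simp)+
    also have "(exp (- x) * (real (Suc r) * x ^ r) - exp (- x) * x ^ Suc r) / fact (Suc r) =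
        poisson_weight x r - poisson_weight x (Suc r)"
      by (simp add: poisson_weight_def diff_divide_distrib del: of_nat_Suc power_Suc)
    finally show ?thesis
      by (simp add: poisson_weight_def)
  qed
  from DERIV_add[OF Suc.IH this] show ?case
    by (simp add: eq)
qed

text \<open>The derivative may vanish at 0. Its sign is therefore used only on the open interval,
  and continuity on the closed one admits \<open>x = 0\<close>.\<close>

lemma poisson_cdf_strict_antimono:
  assumes "0 < r" "0 \<le> x" "x < y"
  shows "poisson_cdf r y < poisson_cdf r x"
proof (rule DERIV_neg_imp_decreasing_open[OF assms(3)])
  obtain r' where r: "r = Suc r'"
    using assms(1) gr0_implies_Suc by blast
  show "\<exists>d. (poisson_cdf r has_real_derivative d) (at z) \<and> d < 0" if "x < z" for z
    using poisson_cdf_has_real_derivative[of r' z] poisson_weight_pos[of z r'] that assms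
    by (intro exI[of _ "- poisson_weight z r'"]) (auto simp: r)
  show "continuous_on {x..y} (poisson_cdf r)"
    unfolding r by (rule DERIV_continuous_on, rule DERIV_subset[OF poisson_cdf_has_real_derivative]) simp
qed

text \<open>The bound \<open>(x/2)\<^sup>k / k! \<le> exp (x/2)\<close> makes the series geometric.\<close>

lemma summable_poisson_cdf:
  assumes "0 < a"
  shows "summable (\<lambda>\<tau>. poisson_cdf r (a * real \<tau>))"
  unfolding poisson_cdf_def
proof (rule summable_sum)
  fix k
  have bound: "poisson_weight x k \<le> 2 ^ k * exp (- x / 2)" if "0 \<le> x" for x
  proof -
    have "(x / 2) ^ k / fact k \<le> exp (x / 2)"
      using sums_le[OF _ sums_If_finite_set[of "{k}"] exp_sums_divide[of "x / 2"],
          of "\<lambda>k. (x / 2) ^ k / fact k"] that by auto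
    then have "2 ^ k * exp (- x) * ((x / 2) ^ k / fact k) \<le> 2 ^ k * exp (- x) * exp (x / 2)"
      by (intro mult_left_mono) auto
    also have "\<dots> = 2 ^ k * exp (- x / 2)"
      by (simp flip: exp_add)
    finally show ?thesis
      by (simp add: poisson_weight_def power_divide)
  qed
  have "summable (\<lambda>\<tau>. 2 ^ k * exp (- a / 2) ^ \<tau>)"
    using assms by (intro summable_mult summable_geometric) auto
  then show "summable (\<lambda>\<tau>. poisson_weight (a * real \<tau>) k)"
  proof (rule summable_comparison_test')
    fix \<tau> :: nat
    have "poisson_weight (a * real \<tau>) k \<le> 2 ^ k * exp (- (a * real \<tau>) / 2)"
      using assms by (intro bound) auto
    also have "exp (- (a * real \<tau>) / 2) = exp (- a / 2) ^ \<tau>"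
      by (simp flip: exp_of_nat_mult add: mult_ac)
    finally show "norm (poisson_weight (a * real \<tau>) k) \<le> 2 ^ k * exp (- a / 2) ^ \<tau>"
      using assms by (simp add: poisson_weight_nonneg)
  qed
qed

text \<open>The termwise difference is a nonnegative series with a positive term.\<close>

lemma suminf_strict_mono:
  fixes f g :: "nat \<Rightarrow> real"
  assumes "summable f" "summable g" "\<And>n. f n \<le> g n" "f i < g i"
  shows "suminf f < suminf g"
  using suminf_pos2[OF summable_diff[OF assms(2,1)], of i] suminf_diff[OF assms(2,1)] assms(3,4)
  by simp

lemma suminf_poisson_cdf_strict_mono:
  assumes "0 < a" "r < r'"
  shows "(\<Sum>\<tau>. poisson_cdf r (a * real \<tau>)) < (\<Sum>\<tau>. poisson_cdf r' (a * real \<tau>))"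
  using assms
  by (intro suminf_strict_mono[where i = 1] summable_poisson_cdf poisson_cdf_mono)
    (auto intro: poisson_cdf_strict_mono)

lemma suminf_poisson_cdf_strict_antimono:
  assumes "0 < r" "0 < a" "a < b"
  shows "(\<Sum>\<tau>. poisson_cdf r (b * real \<tau>)) < (\<Sum>\<tau>. poisson_cdf r (a * real \<tau>))"
proof (rule suminf_strict_mono[where i = 1])
  \<comment> \<open>At \<open>\<tau> = 0\<close> both parameters are 0 and the terms agree;
    strictness starts with \<open>\<tau> = 1\<close>.\<close>
  show "poisson_cdf r (b * real \<tau>) \<le> poisson_cdf r (a * real \<tau>)" for \<tau>
    using poisson_cdf_strict_antimono[of r "a * real \<tau>" "b * real \<tau>"] assms
    by (cases "\<tau> = 0") auto
qed (use assms in \<open>auto intro!: summable_poisson_cdf poisson_cdf_strict_antimono\<close>)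

section \<open>The reputation as an adapted, nondecreasing process\<close>

context honest_seller
begin

lemma slot_len_pos: "0 < slot_len E"
  and arrival_avg_pos: "0 < arrival_avg E"
  and rep_threshold_pos: "0 < rep_threshold E"
  and P_ba_bounds: "0 < P_ba E" "P_ba E \<le> 1"
  using valid unfolding valid_market_def P_ba_def by auto

lemma transaction_rate_pos: "0 < transaction_rate E"
  by (simp add: transaction_rate_def arrival_avg_pos P_ba_bounds)

lemma slot_start_nonneg: "0 \<le> slot_start E \<tau>"
  using slot_len_pos by (simp add: slot_start_def)

lemma slot_start_less_Suc: "slot_start E \<tau> < slot_start E (Suc \<tau>)"
  using slot_len_pos by (simp add: slot_start_def)

lemma sets_history_subset: "sets (F t) \<subseteq> sets M"
  using history by (simp add: subalgebra_def)

lemma measurable_history: "A \<in> sets (F t) \<Longrightarrow> A \<in> sets M"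
  using sets_history_subset by blast

text \<open>Consecutive slots cover adjacent ranges of buyer numbers, so the purchases accumulate.
  This form refers to the time \<open>slot_start E \<tau>\<close> only, which gives
  adaptedness.\<close>

lemma reputation_eq_card:
  assumes "\<omega> \<in> space M"
  shows "reputation E C B \<tau> \<omega> = card {j. j < C (slot_start E \<tau>) \<omega> \<and> B j \<omega>}"
proof (induction \<tau>)
  case 0
  then show ?case
    using no_arrivals[OF assms] by (simp add: slot_start_def)
next
  case (Suc \<tau>)
  have le: "C (slot_start E \<tau>) \<omega> \<le> C (slot_start E (Suc \<tau>)) \<omega>"
    using counting[OF assms slot_start_nonneg] slot_start_less_Suc less_imp_le by blast
  then have eq: "{j. j < C (slot_start E (Suc \<tau>)) \<omega> \<and> B j \<omega>} =
      {j. j < C (slot_start E \<tau>) \<omega> \<and> B j \<omega>} \<union>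
      {j. C (slot_start E \<tau>) \<omega> \<le> j \<and> j < C (slot_start E (Suc \<tau>)) \<omega> \<and> B j \<omega>}"
    by auto
  show ?case
    unfolding eq by (subst card_Un_disjoint) (auto simp: Suc sales_def)
qed

lemma reputation_adapted: "reputation E C B \<tau> \<in> measurable (F (slot_start E \<tau>)) (count_space UNIV)"
proof -
  let ?F = "F (slot_start E \<tau>)" and ?C = "C (slot_start E \<tau>)"
  note [measurable] = arrivals_adapted[OF slot_start_nonneg, of \<tau>]
  have sp: "space ?F = space M"
    by (rule space_F)
  have [measurable]: "Measurable.pred ?F (\<lambda>\<omega>. j < ?C \<omega> \<and> B j \<omega>)" for j
    using decisions_adapted[OF slot_start_nonneg, of j \<tau>] by (simp add: pred_def sp)
  \<comment> \<open>The guard \<open>j < ?C \<omega>\<close> stays in the summand because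
    \<open>decisions_adapted\<close> puts only the conjunction into \<open>?F\<close>. The fixed
    bound \<open>n\<close> is then replaced by the countably valued \<open>?C\<close>.\<close>
  have "(\<lambda>\<omega>. \<Sum>j<n. if j < ?C \<omega> \<and> B j \<omega> then 1 else 0 :: nat)
      \<in> measurable ?F (count_space UNIV)" for n
    by measurable
  from measurable_compose_countable[OF this arrivals_adapted[OF slot_start_nonneg]]
  have meas: "(\<lambda>\<omega>. \<Sum>j<?C \<omega>. if j < ?C \<omega> \<and> B j \<omega> then 1 else 0 :: nat)
      \<in> measurable ?F (count_space UNIV)" .
  have "reputation E C B \<tau> \<omega> = (\<Sum>j<?C \<omega>. if j < ?C \<omega> \<and> B j \<omega> then 1 else 0)"
    if "\<omega> \<in> space ?F" for \<omega>
  proof -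
    have "{..<?C \<omega>} \<inter> {j. B j \<omega>} = {j. j < ?C \<omega> \<and> B j \<omega>}"
      by auto
    then show ?thesis
      using reputation_eq_card[of \<omega> \<tau>] that sp by (simp add: sum.If_cases)
  qed
  from measurable_cong[THEN iffD2, OF this meas] show ?thesis .
qed

lemma mono_reputation: "\<tau> \<le> \<tau>' \<Longrightarrow> reputation E C B \<tau> \<omega> \<le> reputation E C B \<tau>' \<omega>"
  by (rule lift_Suc_mono_le[of "\<lambda>\<tau>. reputation E C B \<tau> \<omega>"]) auto

section \<open>The law of the sales within one slot\<close>

text \<open>\<open>S\<close> encodes the decision pattern, with buyers numbered from the start of
  the slot. Patterns with \<open>l\<close> purchases among \<open>n\<close> arrivals become the
  \<open>l\<close>-subsets of \<open>{..<n}\<close>.\<close>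

definition slot_event :: "nat \<Rightarrow> nat \<Rightarrow> nat set \<Rightarrow> 'a set" where
  "slot_event \<tau> n S = {\<omega> \<in> space M.
     C (slot_start E (Suc \<tau>)) \<omega> - C (slot_start E \<tau>) \<omega> = n \<and>
     (\<forall>j<n. B (C (slot_start E \<tau>) \<omega> + j) \<omega> = (j \<in> S))}"

lemma arrivals_measurable: "C (slot_start E \<tau>) \<in> measurable M (count_space UNIV)"
  using measurable_from_subalg[OF history arrivals_adapted[OF slot_start_nonneg]] .

lemma slot_event_sets: "slot_event \<tau> n S \<in> sets M"
proof -
  note [measurable] = arrivals_measurable[of \<tau>] arrivals_measurable[of "Suc \<tau>"]
  have [measurable]: "Measurable.pred M (B j)" for j
    using decisions_measurable[of j] by (simp add: pred_def)
  \<comment> \<open>The random buyer number takes countably many values.\<close>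
  have [measurable]: "Measurable.pred M (\<lambda>\<omega>. B (C (slot_start E \<tau>) \<omega> + j) \<omega>)" for j
    by (rule measurable_compose_countable[where f = "\<lambda>i \<omega>. B (i + j) \<omega>"]) measurable
  show ?thesis
    unfolding slot_event_def by measurable
qed

text \<open>On \<open>A\<close> the arrival rate and the purchase probability are constant, hence so
  is the conditional probability given by \<open>marked_Poisson\<close> for the whole slot. As
  \<open>A\<close> belongs to the history, integrating over \<open>A\<close> yields the
  product.\<close>

lemma prob_slot_event:
  assumes A: "A \<in> sets (F (slot_start E \<tau>))"
    and below: "\<And>\<omega>. \<omega> \<in> A \<Longrightarrow> reputation E C B \<tau> \<omega> < rep_threshold E"
    and S: "S \<subseteq> {..<n}"
  shows "prob (A \<inter> slot_event \<tau> n S) =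
    prob A * (poisson_weight (arrival_avg E * slot_len E) n * (P_ba E ^ card S * (1 - P_ba E) ^ (n - card S)))"
    (is "_ = _ * ?c")
proof -
  let ?s = "slot_start E \<tau>" and ?t = "slot_start E (Suc \<tau>)"
  interpret G: finite_measure_subalgebra M "F ?s"
    by unfold_locales (rule history)
  have AM: "A \<in> sets M"
    using measurable_history[OF A] .
  have len: "?t - ?s = slot_len E"
    by (simp add: slot_start_def algebra_simps)
  have bern: "(\<Prod>j<n. pmf (bernoulli_pmf (P_ba E)) (j \<in> S)) =
      P_ba E ^ card S * (1 - P_ba E) ^ (n - card S)"
  proof -
    have "(\<Prod>j<n. pmf (bernoulli_pmf (P_ba E)) (j \<in> S)) =
        (\<Prod>j<n. if j \<in> S then P_ba E else 1 - P_ba E)"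
      using P_ba_bounds by (intro prod.cong) auto
    also have "\<dots> = P_ba E ^ card ({..<n} \<inter> S) * (1 - P_ba E) ^ card ({..<n} \<inter> - S)"
      by (subst prod.If_cases) auto
    also have "{..<n} \<inter> S = S"
      using S by auto
    also have "{..<n} \<inter> - S = {..<n} - S"
      by auto
    also have "card ({..<n} - S) = n - card S"
      using S by (simp add: card_Diff_subset finite_subset)
    finally show ?thesis .
  qed
  have cond: "AE \<omega> in M. \<omega> \<in> A \<longrightarrow>
      real_cond_exp M (F ?s) (indicator (slot_event \<tau> n S)) \<omega> = ?c"
    using marked_Poisson[OF order_refl slot_start_less_Suc order_refl, of \<tau> n "\<lambda>j. j \<in> S"]
  proof (eventually_elim, intro impI)
    fix \<omega>
    assume eq: "real_cond_exp M (F ?s) (indicator {\<omega>' \<in> space M. C ?t \<omega>' - C ?s \<omega>' = n \<and>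
          (\<forall>j<n. B (C ?s \<omega>' + j) \<omega>' = (j \<in> S))}) \<omega> =
        pmf (poisson_pmf (arrival_rate E C B \<tau> \<omega> * (?t - ?s))) n *
        (\<Prod>j<n. pmf (bernoulli_pmf (purchase_prob E C B \<tau> \<omega>)) (j \<in> S))"
      and "\<omega> \<in> A"
    \<comment> \<open>A score below the threshold already excludes the reputable label, whatever the
      fraction of positive feedbacks.\<close>
    then have "arrival_rate E C B \<tau> \<omega> = arrival_avg E" "purchase_prob E C B \<tau> \<omega> = P_ba E"
      using below[of \<omega>] by (auto simp: arrival_rate_def purchase_prob_def labeled_reputable_def)
    with eq show "real_cond_exp M (F ?s) (indicator (slot_event \<tau> n S)) \<omega> = ?c"
      using arrival_avg_pos slot_len_pos
      by (simp only: slot_event_def len bern) (simp add: pmf_poisson_eq_weight del: pmf_poisson)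
  qed
  have "prob (A \<inter> slot_event \<tau> n S) = (\<integral>\<omega>\<in>A. indicator (slot_event \<tau> n S) \<omega> \<partial>M)"
    using AM slot_event_sets
    by (simp add: set_lebesgue_integral_def flip: indicator_inter_arith)
  also have "\<dots> = (\<integral>\<omega>\<in>A. real_cond_exp M (F ?s) (indicator (slot_event \<tau> n S)) \<omega> \<partial>M)"
    using A slot_event_sets by (intro G.real_cond_exp_intA) (auto simp: emeasure_eq_measure)
  also have "\<dots> = (\<integral>\<omega>\<in>A. ?c \<partial>M)"
    using cond AM unfolding set_lebesgue_integral_def
    by (intro integral_cong_AE) (auto simp: indicator_def)
  also have "\<dots> = prob A * ?c"
    using AM by (simp add: set_lebesgue_integral_def)
  finally show ?thesis .
qed

text \<open>An outcome determines \<open>n\<close> as the number of arrivals and \<open>S\<close> as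
  the set of those who buy, so the union is also disjoint. Countably many \<open>n\<close>, each
  with finitely many \<open>S\<close>, suffice.\<close>

lemma sales_event_eq_UN:
  "{\<omega> \<in> space M. sales E C B \<tau> \<omega> = l} =
     (\<Union>n. \<Union>S\<in>{S. S \<subseteq> {..<n} \<and> card S = l}. slot_event \<tau> n S)"
proof (intro set_eqI)
  fix \<omega>
  let ?s = "C (slot_start E \<tau>) \<omega>" and ?t = "C (slot_start E (Suc \<tau>)) \<omega>"
  let ?n = "?t - ?s" and ?S = "{j. j < ?t - ?s \<and> B (?s + j) \<omega>}"
  \<comment> \<open>Shifting by \<open>?s\<close> turns numbers relative to the slot into global
    buyer numbers and preserves cardinality.\<close>
  have "{j. ?s \<le> j \<and> j < ?t \<and> B j \<omega>} = (+) ?s ` ?S"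
  proof (intro set_eqI iffI)
    fix j assume "j \<in> {j. ?s \<le> j \<and> j < ?t \<and> B j \<omega>}"
    then show "j \<in> (+) ?s ` ?S"
      by (intro image_eqI[of _ _ "j - ?s"]) auto
  qed auto
  then have sales: "sales E C B \<tau> \<omega> = card ?S"
    by (simp add: sales_def card_image)
  have uniq: "S = ?S" if "S \<subseteq> {..<?n}" "\<forall>j<?n. B (?s + j) \<omega> = (j \<in> S)" for S
    using that by auto
  show "\<omega> \<in> {\<omega> \<in> space M. sales E C B \<tau> \<omega> = l} \<longleftrightarrow>
      \<omega> \<in> (\<Union>n. \<Union>S\<in>{S. S \<subseteq> {..<n} \<and> card S = l}. slot_event \<tau> n S)"
  proof
    assume *: "\<omega> \<in> {\<omega> \<in> space M. sales E C B \<tau> \<omega> = l}"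
    then have "\<omega> \<in> slot_event \<tau> ?n ?S"
      by (auto simp: slot_event_def)
    moreover have "?S \<subseteq> {..<?n}" "card ?S = l"
      using * sales by auto
    ultimately show "\<omega> \<in> (\<Union>n. \<Union>S\<in>{S. S \<subseteq> {..<n} \<and> card S = l}. slot_event \<tau> n S)"
      by blast
  next
    assume "\<omega> \<in> (\<Union>n. \<Union>S\<in>{S. S \<subseteq> {..<n} \<and> card S = l}. slot_event \<tau> n S)"
    then obtain S where "S \<subseteq> {..<?n}" "card S = l" "\<omega> \<in> space M"
        "\<forall>j<?n. B (?s + j) \<omega> = (j \<in> S)"
      unfolding slot_event_def by blast
    with uniq sales show "\<omega> \<in> {\<omega> \<in> space M. sales E C B \<tau> \<omega> = l}"
      by auto
  qed
qed

lemma sales_event_sets: "{\<omega> \<in> space M. sales E C B \<tau> \<omega> = l} \<in> sets M"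
proof -
  have "finite {S :: nat set. S \<subseteq> {..<n} \<and> card S = l}" for n
    by (rule finite_subset[of _ "Pow {..<n}"]) auto
  then show ?thesis
    unfolding sales_event_eq_UN
    by (intro sets.countable_nat_UN) (auto intro!: sets.finite_UN slot_event_sets)
qed

text \<open>Summing the marked Poisson law over all decision patterns with \<open>l\<close> purchases thins the
  arrivals to a Poisson number of sales.\<close>

lemma prob_sales:
  assumes A: "A \<in> sets (F (slot_start E \<tau>))"
    and below: "\<And>\<omega>. \<omega> \<in> A \<Longrightarrow> reputation E C B \<tau> \<omega> < rep_threshold E"
  shows "prob (A \<inter> {\<omega> \<in> space M. sales E C B \<tau> \<omega> = l}) =
    prob A * poisson_weight (transaction_rate E * slot_len E) l"
proof -
  let ?x = "arrival_avg E * slot_len E"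
  define T where "T n = {S :: nat set. S \<subseteq> {..<n} \<and> card S = l}" for n
  define D where "D n = (\<Union>S\<in>T n. A \<inter> slot_event \<tau> n S)" for n
  have fin: "finite (T n)" for n
    unfolding T_def by (rule finite_subset[of _ "Pow {..<n}"]) auto
  have AM: "A \<in> sets M"
    using measurable_history[OF A] .
  have sets: "A \<inter> slot_event \<tau> n S \<in> sets M" for n S
    using AM slot_event_sets by auto
  have probD: "prob (D n) = prob A *
      (poisson_weight ?x n * (real (n choose l) * (P_ba E ^ l * (1 - P_ba E) ^ (n - l))))" for n
  proof -
    have "disjoint_family_on (\<lambda>S. A \<inter> slot_event \<tau> n S) (T n)"
      unfolding disjoint_family_on_def T_def slot_event_def by blast
    then have "prob (D n) = (\<Sum>S\<in>T n. prob (A \<inter> slot_event \<tau> n S))"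
      unfolding D_def using fin sets by (intro finite_measure_finite_Union) auto
    also have "\<dots> = (\<Sum>S\<in>T n. prob A * (poisson_weight ?x n * (P_ba E ^ l * (1 - P_ba E) ^ (n - l))))"
    proof (rule sum.cong[OF refl])
      fix S assume "S \<in> T n"
      then show "prob (A \<inter> slot_event \<tau> n S) =
          prob A * (poisson_weight ?x n * (P_ba E ^ l * (1 - P_ba E) ^ (n - l)))"
        using prob_slot_event[OF A below, of S n] by (simp add: T_def)
    qed
    \<comment> \<open>Equal probabilities over all \<open>l\<close>-subsets produce the binomial
      coefficient required by \<open>poisson_weight_thinning\<close>.\<close>
    also have "card (T n) = n choose l"
      unfolding T_def using n_subsets[of "{..<n}" l] by simp
    then have "(\<Sum>S\<in>T n. prob A * (poisson_weight ?x n * (P_ba E ^ l * (1 - P_ba E) ^ (n - l)))) =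
        prob A * (poisson_weight ?x n * (real (n choose l) * (P_ba E ^ l * (1 - P_ba E) ^ (n - l))))"
      by simp
    finally show ?thesis .
  qed
  have "(\<lambda>n. prob (D n)) sums prob (\<Union>n. D n)"
  proof (rule finite_measure_UNION)
    show "range D \<subseteq> sets M"
      using sets fin unfolding D_def by blast
    show "disjoint_family D"
      by (auto simp: disjoint_family_on_def D_def slot_event_def)
  qed
  moreover have "(\<lambda>n. prob (D n)) sums (prob A * poisson_weight (?x * P_ba E) l)"
    unfolding probD by (intro sums_mult poisson_weight_thinning)
  moreover have "(\<Union>n. D n) = A \<inter> {\<omega> \<in> space M. sales E C B \<tau> \<omega> = l}"
    by (auto simp: sales_event_eq_UN D_def T_def)
  ultimately show ?thesis
    by (auto dest: sums_unique2 simp: transaction_rate_def mult_ac)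
qed

section \<open>The law of the reputation below the threshold\<close>

lemma reputation_event_history:
  "{\<omega> \<in> space M. P (reputation E C B \<tau> \<omega>)} \<in> sets (F (slot_start E \<tau>))"
proof -
  note [measurable] = reputation_adapted[of \<tau>]
  have "{\<omega> \<in> space (F (slot_start E \<tau>)). P (reputation E C B \<tau> \<omega>)} \<in> sets (F (slot_start E \<tau>))"
    by measurable
  then show ?thesis
    by (simp only: space_F)
qed

text \<open>Induction over slots: split by the previous score \<open>k\<close>, apply
  \<open>prob_sales\<close> to each part and convolve. All \<open>k\<close> up to \<open>m\<close>
  occur, so \<open>m\<close> is generalized.\<close>

lemma prob_reputation_eq:
  assumes "m < rep_threshold E"
  shows "prob {\<omega> \<in> space M. reputation E C B \<tau> \<omega> = m} =
    poisson_weight (transaction_rate E * slot_len E * real \<tau>) m"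
  using assms
proof (induction \<tau> arbitrary: m)
  case 0
  then show ?case
    by (simp add: poisson_weight_zero prob_space)
next
  case (Suc \<tau>)
  let ?a = "transaction_rate E * slot_len E"
  let ?R = "\<lambda>k. {\<omega> \<in> space M. reputation E C B \<tau> \<omega> = k}"
    and ?N = "\<lambda>k. {\<omega> \<in> space M. sales E C B \<tau> \<omega> = k}"
  have R: "?R k \<in> sets (F (slot_start E \<tau>))" for k
    by (rule reputation_event_history)
  have "{\<omega> \<in> space M. reputation E C B (Suc \<tau>) \<omega> = m} = (\<Union>k\<in>{..m}. ?R k \<inter> ?N (m - k))"
    by auto
  also have "prob \<dots> = (\<Sum>k\<le>m. prob (?R k \<inter> ?N (m - k)))"
    using measurable_history[OF R] sales_event_sets
    by (intro finite_measure_finite_Union) (auto simp: disjoint_family_on_def)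
  also have "\<dots> = (\<Sum>k\<le>m. poisson_weight (?a * real \<tau>) k * poisson_weight ?a (m - k))"
  proof (rule sum.cong[OF refl])
    \<comment> \<open>Since \<open>k\<close> is at most \<open>m\<close>, the previous score is
      below the threshold too, as \<open>prob_sales\<close> requires.\<close>
    fix k assume "k \<in> {..m}"
    then have "k < rep_threshold E"
      using Suc.prems by simp
    then show "prob (?R k \<inter> ?N (m - k)) = poisson_weight (?a * real \<tau>) k * poisson_weight ?a (m - k)"
      using prob_sales[OF R, of k "m - k"] Suc.IH[of k] by simp
  qed
  also have "\<dots> = poisson_weight (?a * real (Suc \<tau>)) m"
    unfolding poisson_weight_convolution[symmetric] by (simp add: algebra_simps)
  finally show ?case .
qed

lemma prob_reputation_less:
  "prob {\<omega> \<in> space M. reputation E C B \<tau> \<omega> < rep_threshold E} =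
     poisson_cdf (rep_threshold E) (transaction_rate E * slot_len E * real \<tau>)"
proof -
  have "{\<omega> \<in> space M. reputation E C B \<tau> \<omega> < rep_threshold E} =
      (\<Union>m\<in>{..<rep_threshold E}. {\<omega> \<in> space M. reputation E C B \<tau> \<omega> = m})"
    by auto
  also have "prob \<dots> = (\<Sum>m<rep_threshold E. prob {\<omega> \<in> space M. reputation E C B \<tau> \<omega> = m})"
    using measurable_history[OF reputation_event_history]
    by (intro finite_measure_finite_Union) (auto simp: disjoint_family_on_def)
  finally show ?thesis
    by (simp add: poisson_cdf_def prob_reputation_eq)
qed

section \<open>The expected ramp up time\<close>

text \<open>By monotonicity of the score, the slots below the threshold are exactly those before the
  first passage; counting them gives its index.\<close>

lemma ramp_up_time_eq_suminf:
  assumes "\<omega> \<in> space M"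
  shows "ramp_up_time E C B \<omega> = ennreal (slot_len E) *
    (\<Sum>\<tau>. indicator {\<omega> \<in> space M. reputation E C B \<tau> \<omega> < rep_threshold E} \<omega>)"
proof (cases "\<exists>\<tau>. rep_threshold E \<le> reputation E C B \<tau> \<omega>")
  case True
  define T where "T = (LEAST \<tau>. rep_threshold E \<le> reputation E C B \<tau> \<omega>)"
  have T: "rep_threshold E \<le> reputation E C B T \<omega>"
    unfolding T_def using True by (rule LeastI_ex)
  have iff: "reputation E C B \<tau> \<omega> < rep_threshold E \<longleftrightarrow> \<tau> < T" for \<tau>
    using T mono_reputation[of T \<tau> \<omega>] not_less_Least[of \<tau> "\<lambda>\<tau>. rep_threshold E \<le> reputation E C B \<tau> \<omega>"]
    by (fold T_def) (meson leD leI le_trans)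
  have "(\<Sum>\<tau>. indicator {\<omega> \<in> space M. reputation E C B \<tau> \<omega> < rep_threshold E} \<omega>) =
      (\<Sum>\<tau><T. indicator {\<omega> \<in> space M. reputation E C B \<tau> \<omega> < rep_threshold E} \<omega> :: ennreal)"
    by (intro suminf_finite) (auto simp: iff)
  also have "\<dots> = ennreal (real T)"
    using assms by (simp add: iff ennreal_of_nat_eq_real_of_nat)
  finally show ?thesis
    using True slot_len_pos by (simp add: ramp_up_time_def T_def ennreal_mult)
next
  case False
  \<comment> \<open>If the threshold is never reached, the count is infinite, and a positive slot
    length keeps the product infinite.\<close>
  then have "(\<Sum>\<tau>. indicator {\<omega> \<in> space M. reputation E C B \<tau> \<omega> < rep_threshold E} \<omega>) = (\<Sum>\<tau>. 1 :: ennreal)"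
    using assms by (intro suminf_cong) (auto simp: not_le)
  also have "\<dots> = \<infinity>"
    by (simp flip: nn_integral_count_space_nat)
  finally show ?thesis
    using False slot_len_pos by (simp add: ramp_up_time_def ennreal_mult_top)
qed

text \<open>Integral and series of nonnegative terms are exchanged; summability then turns the
  extended sum into a real one, so the expectation is finite.\<close>

lemma expected_ramp_up_time_eq:
  "expected_ramp_up_time M E C B = ennreal (slot_len E *
     (\<Sum>\<tau>. poisson_cdf (rep_threshold E) (transaction_rate E * slot_len E * real \<tau>)))"
proof -
  let ?A = "\<lambda>\<tau>. {\<omega> \<in> space M. reputation E C B \<tau> \<omega> < rep_threshold E}"
  let ?p = "\<lambda>\<tau>. poisson_cdf (rep_threshold E) (transaction_rate E * slot_len E * real \<tau>)"
  have [measurable]: "?A \<tau> \<in> sets M" for \<tau>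
    using measurable_history[OF reputation_event_history] .
  have a: "0 < transaction_rate E * slot_len E"
    using transaction_rate_pos slot_len_pos by simp
  have nonneg: "0 \<le> ?p \<tau>" for \<tau>
    using a by (intro poisson_cdf_nonneg) simp
  have "expected_ramp_up_time M E C B = (\<integral>\<^sup>+ \<omega>. ennreal (slot_len E) * (\<Sum>\<tau>. indicator (?A \<tau>) \<omega>) \<partial>M)"
    unfolding expected_ramp_up_time_def by (intro nn_integral_cong ramp_up_time_eq_suminf)
  also have "\<dots> = ennreal (slot_len E) * (\<Sum>\<tau>. emeasure M (?A \<tau>))"
    by (simp add: nn_integral_cmult nn_integral_suminf)
  also have "(\<Sum>\<tau>. emeasure M (?A \<tau>)) = (\<Sum>\<tau>. ennreal (?p \<tau>))"
    by (simp add: emeasure_eq_measure prob_reputation_less)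
  also have "\<dots> = ennreal (\<Sum>\<tau>. ?p \<tau>)"
    using nonneg summable_poisson_cdf[OF a] by (rule suminf_ennreal2)
  finally show ?thesis
    using slot_len_pos nonneg summable_poisson_cdf[OF a] by (simp add: ennreal_mult suminf_nonneg)
qed

text \<open>Comparison with threshold 0, whose series is zero. Positivity of the larger side is what
  carries a strict real inequality over to \<open>ennreal\<close>.\<close>

lemma suminf_poisson_cdf_pos:
  "0 < (\<Sum>\<tau>. poisson_cdf (rep_threshold E) (transaction_rate E * slot_len E * real \<tau>))"
  using suminf_poisson_cdf_strict_mono[of "transaction_rate E * slot_len E" 0 "rep_threshold E"]
    transaction_rate_pos slot_len_pos rep_threshold_pos by (simp add: poisson_cdf_def)

end

text \<open>The summability clauses exclude the default value 0 of a divergent infinite sum. The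
  sellers compared may live on another probability space, over the type \<open>'b\<close>.\<close>

theorem theorem4p1:
  fixes M :: "'a measure" and F :: "real \<Rightarrow> 'a measure" and E :: market
    and C :: "real \<Rightarrow> 'a \<Rightarrow> nat" and B :: "nat \<Rightarrow> 'a \<Rightarrow> bool"
  assumes "honest_seller M F E C B"
  shows
    "(let a = (\<lambda>\<tau>::nat. transaction_rate E * real (\<tau> - 1) * slot_len E);
          f = (\<lambda>\<tau>::nat. 1 - (\<Sum>\<^sub>\<infinity>k\<in>{rep_threshold E..}. exp (- a \<tau>) * (a \<tau> ^ k / fact k)))
      in (\<forall>\<tau>\<in>{1..}. (\<lambda>k. exp (- a \<tau>) * (a \<tau> ^ k / fact k)) summable_on {rep_threshold E..}) \<and>
         f summable_on {1..} \<and>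
         expected_ramp_up_time M E C B = ennreal (slot_len E * (\<Sum>\<^sub>\<infinity>\<tau>\<in>{1..}. f \<tau>)))
     \<and> (\<forall>(M' :: 'b measure) F' E' C' B'.
          honest_seller M' F' E' C' B' \<and>
          slot_len E' = slot_len E \<and> transaction_rate E' = transaction_rate E \<and>
          rep_threshold E < rep_threshold E'
          \<longrightarrow> expected_ramp_up_time M E C B < expected_ramp_up_time M' E' C' B')
     \<and> (\<forall>(M' :: 'b measure) F' E' C' B'.
          honest_seller M' F' E' C' B' \<and>
          slot_len E' = slot_len E \<and> rep_threshold E' = rep_threshold E \<and>
          transaction_rate E < transaction_rate E'
          \<longrightarrow> expected_ramp_up_time M' E' C' B' < expected_ramp_up_time M E C B)"
proof -
  interpret S: honest_seller M F E C B
    by (rule assms)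
  define x where "x = transaction_rate E * slot_len E"
  define a where "a = (\<lambda>\<tau>::nat. transaction_rate E * real (\<tau> - 1) * slot_len E)"
  define f where "f = (\<lambda>\<tau>. 1 - (\<Sum>\<^sub>\<infinity>k\<in>{rep_threshold E..}. exp (- a \<tau>) * (a \<tau> ^ k / fact k)))"
  have x: "0 < x"
    unfolding x_def using S.transaction_rate_pos S.slot_len_pos by simp
  \<comment> \<open>Reindexing by \<open>Suc\<close> matches the sum from 1 with the slots from 0.
    Truncated subtraction gives \<open>a 0 = 0\<close>, so nonnegativity holds for every
    \<open>\<tau>\<close>.\<close>
  have a: "a (Suc \<tau>) = x * real \<tau>" "0 \<le> a \<tau>" for \<tau>
    using S.transaction_rate_pos S.slot_len_pos by (simp_all add: a_def x_def)
  have tail: "((\<lambda>k. exp (- a \<tau>) * (a \<tau> ^ k / fact k)) has_sum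
      (1 - poisson_cdf (rep_threshold E) (a \<tau>))) {rep_threshold E..}" for \<tau>
    using poisson_weight_has_sum_atLeast[OF a(2)] by (simp only: poisson_weight_def[abs_def])
  have f: "f \<tau> = poisson_cdf (rep_threshold E) (a \<tau>)" for \<tau>
    using infsumI[OF tail] by (simp add: f_def)
  have "((\<lambda>\<tau>. f (Suc \<tau>)) has_sum (\<Sum>\<tau>. poisson_cdf (rep_threshold E) (x * real \<tau>))) UNIV"
    using x summable_poisson_cdf[OF x] unfolding f a(1)
    by (intro norm_summable_imp_has_sum) (auto simp: poisson_cdf_nonneg)
  moreover have "bij_betw Suc UNIV {1..}"
    by (auto simp: bij_betw_def image_iff Suc_le_eq gr0_conv_Suc)
  ultimately have "(f has_sum (\<Sum>\<tau>. poisson_cdf (rep_threshold E) (x * real \<tau>))) {1..}"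
    using has_sum_reindex_bij_betw by blast
  then have "f summable_on {1..}"
      "expected_ramp_up_time M E C B = ennreal (slot_len E * (\<Sum>\<^sub>\<infinity>\<tau>\<in>{1..}. f \<tau>))"
    by (auto simp: S.expected_ramp_up_time_eq x_def has_sum_imp_summable infsumI)
  then have "(let a = (\<lambda>\<tau>::nat. transaction_rate E * real (\<tau> - 1) * slot_len E);
          f = (\<lambda>\<tau>::nat. 1 - (\<Sum>\<^sub>\<infinity>k\<in>{rep_threshold E..}. exp (- a \<tau>) * (a \<tau> ^ k / fact k)))
      in (\<forall>\<tau>\<in>{1..}. (\<lambda>k. exp (- a \<tau>) * (a \<tau> ^ k / fact k)) summable_on {rep_threshold E..}) \<and>
         f summable_on {1..} \<and>
         expected_ramp_up_time M E C B = ennreal (slot_len E * (\<Sum>\<^sub>\<infinity>\<tau>\<in>{1..}. f \<tau>)))"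
    using has_sum_imp_summable[OF tail] unfolding Let_def f_def a_def by blast
  moreover have "expected_ramp_up_time M E C B < expected_ramp_up_time M' E' C' B'"
    if S': "honest_seller M' F' E' C' B'" and eq: "slot_len E' = slot_len E"
      "transaction_rate E' = transaction_rate E" "rep_threshold E < rep_threshold E'"
    for M' :: "'b measure" and F' E' C' B'
    unfolding S.expected_ramp_up_time_eq honest_seller.expected_ramp_up_time_eq[OF S'] eq(1,2)
    using S.slot_len_pos honest_seller.suminf_poisson_cdf_pos[OF S', unfolded eq(1,2)] x eq(3)
    by (intro ennreal_lessI mult_strict_left_mono suminf_poisson_cdf_strict_mono)
      (auto simp: x_def)
  moreover have "expected_ramp_up_time M' E' C' B' < expected_ramp_up_time M E C B"
    if S': "honest_seller M' F' E' C' B'" and eq: "slot_len E' = slot_len E"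
      "rep_threshold E' = rep_threshold E" "transaction_rate E < transaction_rate E'"
    for M' :: "'b measure" and F' E' C' B'
    unfolding S.expected_ramp_up_time_eq honest_seller.expected_ramp_up_time_eq[OF S'] eq(1,2)
    using S.slot_len_pos S.rep_threshold_pos S.suminf_poisson_cdf_pos eq(3)
      S.transaction_rate_pos
    by (intro ennreal_lessI mult_strict_left_mono suminf_poisson_cdf_strict_antimono) auto
  ultimately show ?thesis
    by blast
qed

end
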